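(* Let $A\subseteq(0,\infty)$ with $|A|=k$ be a union of two geometric progressions with the same common ratio $r>1$. Then: (a) if $k$ is odd, $r\in\mathbb{Q}$ and $r\ne 2$, then $|A+A|\ge (k^2-3k+8)/2$; (b) if $k$ is even, $r\in\mathbb{Q}$ and $r\ne 2$, then $|A+A|\ge (k^2-3k+10)/2$; (c) if $r\ge 2$, then $|A+A|\ge \left\lceil ((k+1)^2+3)/4\right\rceil$; (d) if $k=8$, $r\in\mathbb{Q}$ and $r\ge 2$, then $|A+A|\ge 22$.
   Context: $A+A=\{a+b:a,b\in A\}$. A geometric progression with common ratio $r>1$ is a set of the form $\{x,rx,\dots,r^{n-1}x\}$ with $x>0$.
   Formalization: Assumes k ≥ 2 throughout and k ≠ 2 in (b): for k = 1 (both progressions equal to {x}) |A+A| = 1 violates (a) and (c), and for k = 2 always |A+A| = 3, which violates the bound 4 in (b). *)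

theory Defs
  imports Complex_Main "HOL-Library.Set_Algebras"
begin

(* The sumset A + A is the pointwise addition of sets from Set_Algebras. *)

definition geometric_progression :: "real \<Rightarrow> real set \<Rightarrow> bool" where
  "geometric_progression r P \<longleftrightarrow>
     r > 1 \<and> (\<exists>x > 0. \<exists>n \<ge> 1. P = (\<lambda>i. r ^ i * x) ` {..<n})"

end

theory Submission
  imports Defs "HOL-Library.Multiset"
begin

text \<open>
  Rational ratio \<open>r = p / q \<noteq> 2\<close> in lowest terms: if two finite multisets of exponents have equal power
  sums, then \<open>p\<close> divides the difference of the multiplicities of the least exponent at which they
  differ. Since \<open>p \<ge> 3\<close>, a sum of at most three powers of \<open>r\<close> determines
  its exponents. If both
  progressions \<open>P\<close>, \<open>Q\<close> lie in one progression, all sums are therefore distinct. Otherwise the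
  coincidences of each of the four kinds (\<open>P + P\<close> with \<open>P + Q\<close>, \<open>Q + Q\<close> with \<open>P + Q\<close>, \<open>P + P\<close> with \<open>Q + Q\<close>,
  and inside \<open>P + Q\<close>) form a single family up to multiplication by powers of \<open>r\<close>, so that altogether at
  most \<open>2 k - 4\<close> (for even \<open>k\<close>, \<open>2 k - 5\<close>) of the \<open>k (k + 1) / 2\<close> sums are lost.

  Ratio \<open>r \<ge> 2\<close>: all but the two largest elements of \<open>A\<close> are at most half the maximum \<open>M\<close>, so deleting
  these two destroys at least the \<open>card A\<close> sums \<open>M + a\<close>; now induct in steps of two. For \<open>r = 2\<close>
  and \<open>k = 8\<close>, the first step destroys one further sum.
\<close>

section \<open>Uniqueness of short power sums\<close>

lemma sum_mset_powers_eq_sum: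
  fixes r :: "'a::comm_semiring_1"
  assumes "set_mset M \<subseteq> {..K}"
  shows "(\<Sum>i\<in>#M. r ^ i) = (\<Sum>i\<le>K. of_nat (count M i) * r ^ i)"
  using assms
proof (induction M)
  case (add x M)
  have "(\<Sum>i\<le>K. of_nat (count (add_mset x M) i) * r ^ i) =
        (\<Sum>i\<le>K. (if i = x then r ^ i else 0) + of_nat (count M i) * r ^ i)"
    by (intro sum.cong) (auto simp: algebra_simps)
  also have "\<dots> = r ^ x + (\<Sum>i\<le>K. of_nat (count M i) * r ^ i)"
    using add.prems by (simp add: sum.distrib sum.delta)
  finally show ?case using add by simp
qed simp

text \<open>Multiplying the difference of the two sums by \<open>q ^ K\<close> gives an integer
  identity. Its terms below the least differing exponent \<open>e\<close> vanish and those above are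
  divisible by \<open>p ^ (e + 1)\<close>, so \<open>p\<close> divides the coefficient at
  \<open>e\<close> times a power of \<open>q\<close>, which is coprime to \<open>p\<close>.\<close>

lemma numerator_dvd_count_diff:
  fixes M N :: "nat multiset" and p q :: nat
  assumes cop: "coprime p q" and q: "q > 0" and p: "p > 0"
    and eq: "(\<Sum>i\<in>#M. (real p / real q) ^ i) = (\<Sum>i\<in>#N. (real p / real q) ^ i)"
    and ne: "M \<noteq> N"
  obtains e where "count M e \<noteq> count N e" "\<And>x. x < e \<Longrightarrow> count M x = count N x"
    "int p dvd int (count M e) - int (count N e)"
proof -
  define e where "e = (LEAST x. count M x \<noteq> count N x)"
  have ex: "\<exists>x. count M x \<noteq> count N x" using ne by (auto simp: multiset_eq_iff)
  have e1: "count M e \<noteq> count N e" unfolding e_def using ex by (rule LeastI_ex)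
  have e2: "count M x = count N x" if "x < e" for x
    using not_less_Least[of x "\<lambda>x. count M x \<noteq> count N x"] that unfolding e_def by blast
  define K where "K = Max (insert e (set_mset M \<union> set_mset N))"
  have K: "set_mset M \<subseteq> {..K}" "set_mset N \<subseteq> {..K}" "e \<le> K" by (auto simp: K_def)
  define d where "d i = int (count M i) - int (count N i)" for i
  have d0: "d i = 0" if "i < e" for i using e2[OF that] by (simp add: d_def)
  have "(\<Sum>i\<le>K. of_int (d i) * (real p / real q) ^ i) = 0"
    using eq unfolding sum_mset_powers_eq_sum[OF K(1)] sum_mset_powers_eq_sum[OF K(2)]
    by (simp add: d_def algebra_simps sum_subtractf)
  hence "0 = (\<Sum>i\<le>K. of_int (d i) * (real p / real q) ^ i) * real q ^ K" by simp
  also have "\<dots> = (\<Sum>i\<le>K. of_int (d i) * real p ^ i * real q ^ (K - i))"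
    unfolding sum_distrib_right
    by (intro sum.cong refl) (use q in \<open>auto simp: power_divide power_diff\<close>)
  also have "\<dots> = of_int (\<Sum>i\<le>K. d i * int p ^ i * int q ^ (K - i))" by simp
  finally have "(\<Sum>i\<le>K. d i * int p ^ i * int q ^ (K - i)) = 0" by linarith
  moreover have "(\<Sum>i\<le>K. d i * int p ^ i * int q ^ (K - i)) =
     d e * int p ^ e * int q ^ (K - e) + (\<Sum>i\<in>{..K} - {e}. d i * int p ^ i * int q ^ (K - i))"
    using K(3) by (subst sum.remove[of _ e]) auto
  moreover have "int p ^ Suc e dvd (\<Sum>i\<in>{..K} - {e}. d i * int p ^ i * int q ^ (K - i))"
  proof (rule dvd_sum)
    fix i assume "i \<in> {..K} - {e}"
    hence "i < e \<or> Suc e \<le> i" by auto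
    thus "int p ^ Suc e dvd d i * int p ^ i * int q ^ (K - i)"
      using d0 le_imp_power_dvd[of "Suc e" i "int p"] by auto
  qed
  moreover have "D dvd X" if "S = 0" "S = X + Y" "D dvd Y" for D S X Y :: int
    using that by (metis add.commute dvd_0_right dvd_add_right_iff)
  ultimately have "int p ^ Suc e dvd d e * int p ^ e * int q ^ (K - e)" by blast
  hence "int p ^ e * int p dvd int p ^ e * (d e * int q ^ (K - e))"
    by (simp add: mult_ac)
  hence "int p dvd d e * int q ^ (K - e)" using p by simp
  moreover have "coprime (int p) (int q ^ (K - e))" using cop by simp
  ultimately have "int p dvd d e" by (simp add: coprime_dvd_mult_left_iff)
  thus thesis using that[of e] e1 e2 unfolding d_def by blast
qed

text \<open>Serves to rule out that the multiset with the larger multiplicity at \<open>e\<close>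
  consists of copies of \<open>e\<close> alone: the other one, of equal size and without smaller
  exponents, would have a larger sum.\<close>

lemma sum_mset_powers_replicate_less:
  fixes r :: real
  assumes r: "r > 1" and "size N = s" "\<And>x. x \<in># N \<Longrightarrow> e \<le> x" "count N e < s"
  shows "(\<Sum>i\<in>#replicate_mset s e. r ^ i) < (\<Sum>i\<in>#N. r ^ i)"
proof -
  obtain x where x: "x \<in># N" "x \<noteq> e"
  proof (rule ccontr)
    assume "\<not> thesis"
    hence "\<forall>x\<in>#N. x = e" using that by blast
    hence "N = replicate_mset (size N) e" by (metis set_mset_subset_singletonD singletonI subsetI)
    with assms show False by (metis count_replicate_mset less_irrefl)
  qed
  then obtain N' where N': "N = add_mset x N'" by (metis multi_member_split)
  have "(\<Sum>i\<in>#replicate_mset (size N') e. r ^ i) \<le> (\<Sum>i\<in>#N'. r ^ i)"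
    if "\<And>x. x \<in># N' \<Longrightarrow> e \<le> x" for N' :: "nat multiset"
    using that
  proof (induction N')
    case (add y N')
    have "r ^ e \<le> r ^ y" using add.prems r by (intro power_increasing) auto
    with add show ?case by auto
  qed simp
  moreover have "r ^ e < r ^ x" using x assms(3)[of x] r by (intro power_strict_increasing) auto
  ultimately show ?thesis using assms(2,3) unfolding N' by (force intro: add_less_le_mono)
qed

text \<open>At the least exponent of disagreement the larger multiplicity is at least
  \<open>p\<close>. The strict upper bound makes this useful: for size at most \<open>p\<close>
  nothing is left, and for size 4 with \<open>p \<ge> 3\<close> only multiplicity exactly 3.\<close>

lemma numerator_le_count_if_power_sums_eq:
  fixes M N :: "nat multiset" and p q :: nat
  assumes cop: "coprime p q" and q: "q > 0" and r: "real p / real q > 1"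
    and eq: "(\<Sum>i\<in>#M. (real p / real q) ^ i) = (\<Sum>i\<in>#N. (real p / real q) ^ i)"
    and ne: "M \<noteq> N" and sz: "size M = size N"
  shows "\<exists>e. p \<le> count M e \<and> count M e < size M \<or> p \<le> count N e \<and> count N e < size N"
proof -
  have key: "p \<le> count M e \<and> count M e < size M"
    if gt: "count M e > count N e" and low: "\<And>x. x < e \<Longrightarrow> count M x = count N x"
      and dvd: "int p dvd int (count M e) - int (count N e)"
      and sz: "size M = size N"
      and eq: "(\<Sum>i\<in>#M. (real p / real q) ^ i) = (\<Sum>i\<in>#N. (real p / real q) ^ i)"
    for e and M N :: "nat multiset"
  proof
    have "int p \<le> int (count M e) - int (count N e)" using dvd gt by (intro zdvd_imp_le) auto
    thus "p \<le> count M e" by linarith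
    show "count M e < size M"
    proof (rule ccontr)
      assume "\<not> ?thesis"
      hence s: "count M e = size M" using count_le_size[of M e] by linarith
      hence rep: "M = replicate_mset (size M) e"
        by (metis count_le_replicate_mset_subset_eq mset_subset_size nat_neq_iff order_refl
            size_replicate_mset subset_mset.le_imp_less_or_eq)
      have "e \<le> x" if "x \<in># N" for x
      proof (rule ccontr)
        assume "\<not> ?thesis"
        hence "count M x > 0" using low[of x] that by simp
        with rep \<open>\<not> e \<le> x\<close> show False by (metis count_replicate_mset less_irrefl order_refl)
      qed
      from sum_mset_powers_replicate_less[OF r refl this] gt s sz
      have "(\<Sum>i\<in>#replicate_mset (size M) e. (real p / real q) ^ i) < (\<Sum>i\<in>#N. (real p / real q) ^ i)"
        by simp
      with eq show False by (simp flip: rep)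
    qed
  qed
  have "p > 0" using r by (cases p) auto
  from numerator_dvd_count_diff[OF cop q this eq ne] obtain e where
    e: "count M e \<noteq> count N e" "\<And>x. x < e \<Longrightarrow> count M x = count N x"
    "int p dvd int (count M e) - int (count N e)" by blast
  have "int p dvd int (count N e) - int (count M e)"
    using e(3) by (metis dvd_minus_iff minus_diff_eq)
  thus ?thesis using key[of N e M] key[of M e N] e sz eq by (metis linorder_neqE_nat)
qed

text \<open>The only reduced fraction above 1 with numerator at most 2 is \<open>2 / 1\<close>; this
  is how \<open>r \<noteq> 2\<close> enters the argument.\<close>

lemma Rats_fraction_gt_1E:
  fixes r :: real
  assumes "r \<in> \<rat>" "r > 1"
  obtains p q :: nat where "coprime p q" "q > 0" "r = real p / real q" "p \<ge> 2" "r \<noteq> 2 \<longrightarrow> p \<ge> 3"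
proof -
  from Rats_abs_nat_div_natE[OF assms(1)] obtain p q :: nat
    where pq: "q \<noteq> 0" "\<bar>r\<bar> = real p / real q" "coprime p q" by blast
  have r: "r = real p / real q" using pq(2) assms(2) by simp
  have "p > q" using r assms(2) pq(1) by (simp add: less_divide_eq)
  moreover have "p \<ge> 3" if "r \<noteq> 2"
  proof (rule ccontr)
    assume "\<not> p \<ge> 3"
    hence "p = 2 \<and> q = 1" using \<open>p > q\<close> pq(1) by linarith
    with r that show False by simp
  qed
  ultimately show thesis using that[of p q] pq r by linarith
qed

lemma sum_two_powers_unique:
  fixes r :: real
  assumes r: "r \<in> \<rat>" "r > 1" and eq: "r ^ a + r ^ b = r ^ c + r ^ d"
  shows "{#a, b#} = {#c, d#}"
proof (rule ccontr)
  assume ne: "\<not> ?thesis"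
  from r obtain p q where pq: "coprime p q" "q > 0" "r = real p / real q" "p \<ge> 2"
    by (rule Rats_fraction_gt_1E)
  have "\<exists>e. p \<le> count {#a, b#} e \<and> count {#a, b#} e < size {#a, b#} \<or>
            p \<le> count {#c, d#} e \<and> count {#c, d#} e < size {#c, d#}"
    by (rule numerator_le_count_if_power_sums_eq[OF pq(1,2) _ _ ne])
       (use r eq pq(3) in simp_all)
  with pq(4) show False by auto
qed

text \<open>For \<open>r = 2\<close> this fails: 1 + 1 + 4 = 2 + 2 + 2.\<close>

lemma sum_three_powers_unique:
  fixes r :: real
  assumes r: "r \<in> \<rat>" "r > 1" "r \<noteq> 2"
    and eq: "r ^ a + r ^ b + r ^ c = r ^ a' + r ^ b' + r ^ c'"
  shows "{#a, b, c#} = {#a', b', c'#}"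
proof (rule ccontr)
  assume ne: "\<not> ?thesis"
  from r(1,2) obtain p q where pq: "coprime p q" "q > 0" "r = real p / real q"
    "r \<noteq> 2 \<longrightarrow> p \<ge> 3" by (rule Rats_fraction_gt_1E)
  have "\<exists>e. p \<le> count {#a, b, c#} e \<and> count {#a, b, c#} e < size {#a, b, c#} \<or>
            p \<le> count {#a', b', c'#} e \<and> count {#a', b', c'#} e < size {#a', b', c'#}"
    by (rule numerator_le_count_if_power_sums_eq[OF pq(1,2) _ _ ne])
       (use r eq pq(3) in \<open>simp_all add: algebra_simps\<close>)
  moreover have "p \<ge> 3" using pq(4) r(3) by blast
  ultimately show False by (auto simp del: count_add_mset)
qed

text \<open>A failure would need an exponent of multiplicity exactly 3. Three equal exponents in
  such an expansion force \<open>a = b\<close> and \<open>c = d\<close>, and then all four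
  agree.\<close>

lemma product_of_power_sums_unique:
  fixes r :: real
  assumes r: "r \<in> \<rat>" "r > 1" "r \<noteq> 2"
    and eq: "(r ^ a + r ^ b) * (r ^ c + r ^ d) = (r ^ a' + r ^ b') * (r ^ c' + r ^ d')"
  shows "{#a + c, a + d, b + c, b + d#} = {#a' + c', a' + d', b' + c', b' + d'#}"
proof (rule ccontr)
  assume ne: "\<not> ?thesis"
  from r(1,2) obtain p q where pq: "coprime p q" "q > 0" "r = real p / real q"
    "r \<noteq> 2 \<longrightarrow> p \<ge> 3" by (rule Rats_fraction_gt_1E)
  let ?M = "{#a + c, a + d, b + c, b + d#}" and ?N = "{#a' + c', a' + d', b' + c', b' + d'#}"
  have sz: "size ?M = 4" "size ?N = 4" by simp_all
  have "\<exists>e. p \<le> count ?M e \<and> count ?M e < size ?M \<or> p \<le> count ?N e \<and> count ?N e < size ?N"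
    by (rule numerator_le_count_if_power_sums_eq[OF pq(1,2) _ _ ne])
       (use r eq pq(3) in \<open>simp_all add: algebra_simps power_add\<close>)
  then obtain e where e: "p \<le> count ?M e \<and> count ?M e < 4 \<or> p \<le> count ?N e \<and> count ?N e < 4"
    unfolding sz by blast
  have no3: "\<not> (3 \<le> count {#a + c, a + d, b + c, b + d#} e \<and>
      count {#a + c, a + d, b + c, b + d#} e < 4)" for a b c d e :: nat
    by (auto split: if_splits)
  have "p \<ge> 3" using pq(4) r(3) by blast
  moreover have "\<not> (3 \<le> count ?M e \<and> count ?M e < 4)" "\<not> (3 \<le> count ?N e \<and> count ?N e < 4)"
    by (rule no3)+
  ultimately show False using e by (meson order_trans)
qed

text \<open>Move the negative terms across. If \<open>u\<close> and \<open>v\<close> differed, the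
  smaller would be the least exponent and occur exactly once, on one side only, although
  \<open>p \<ge> 2\<close> divides the difference of multiplicities. After cancelling, three powers
  stand on each side; they determine the two factors up to order, and \<open>d \<noteq> f'\<close>
  excludes the swap.\<close>

lemma product_of_power_differences_unique:
  fixes r :: real
  assumes r: "r \<in> \<rat>" "r > 1" "r \<noteq> 2"
    and pos: "d > 0" "f > 0" "d' > 0" "f' > 0" and ne: "d \<noteq> f'"
    and eq: "r ^ u * (r ^ d - 1) * (r ^ f - 1) = r ^ v * (r ^ d' - 1) * (r ^ f' - 1)"
  shows "u = v \<and> d = d' \<and> f = f'"
proof -
  from r(1,2) obtain p q where pq: "coprime p q" "q > 0" "r = real p / real q" "p \<ge> 2"
    by (rule Rats_fraction_gt_1E)
  have False if "u < v" "d > 0" "f > 0" "d' > 0" "f' > 0"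
    and eq: "r ^ u * (r ^ d - 1) * (r ^ f - 1) = r ^ v * (r ^ d' - 1) * (r ^ f' - 1)"
    for u v d f d' f'
  proof -
    let ?M = "{#u, u + d + f, v + d', v + f'#}" and ?N = "{#v, v + d' + f', u + d, u + f#}"
    have u: "count ?M u = 1" "count ?N u = 0" using that by auto
    have "(\<Sum>i\<in>#?M. r ^ i) = (\<Sum>i\<in>#?N. r ^ i)"
      using eq by (simp add: algebra_simps power_add)
    moreover have "?M \<noteq> ?N" using u by (metis zero_neq_one)
    ultimately obtain e where e: "count ?M e \<noteq> count ?N e"
      "\<And>x. x < e \<Longrightarrow> count ?M x = count ?N x" "int p dvd int (count ?M e) - int (count ?N e)"
      using numerator_dvd_count_diff[OF pq(1,2), of ?M ?N] pq(3,4) by auto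
    have "e \<le> u" using e(2)[of u] u by linarith
    moreover have "e \<ge> u"
    proof (rule ccontr)
      assume "\<not> ?thesis"
      with e(1) that(1) show False by (auto split: if_splits)
    qed
    ultimately have "e = u" by simp
    with e(3) u pq(4) show False by (simp del: count_add_mset)
  qed
  from this[OF _ pos eq] this[OF _ pos(3,4,1,2) eq[symmetric]] have uv: "u = v"
    by (metis linorder_neqE_nat)
  have "(r ^ d - 1) * (r ^ f - 1) = (r ^ d' - 1) * (r ^ f' - 1)"
    using eq uv r(2) by (simp add: mult.assoc)
  hence "r ^ (d + f) + r ^ d' + r ^ f' = r ^ (d' + f') + r ^ d + r ^ f"
    by (simp add: algebra_simps power_add)
  from sum_three_powers_unique[OF r this]
  have *: "{#d + f, d', f'#} = {#d' + f', d, f#}" .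
  have "d + f \<in># {#d' + f', d, f#}" by (simp flip: *)
  hence "d + f = d' + f'" using pos by auto
  with * have "{#d', f'#} = {#d, f#}" by simp
  with ne uv show ?thesis by (auto simp: add_eq_conv_ex)
qed

text \<open>Inserting a new \<open>b\<close> adds the \<open>card B + 1\<close> sums that involve
  \<open>b\<close>; the Sidon property keeps them apart from \<open>B + B\<close>.\<close>

lemma card_sumset_Sidon:
  fixes B :: "real set"
  assumes "finite B" and "\<And>a b c d. \<lbrakk>a \<in> B; b \<in> B; c \<in> B; d \<in> B; a + b = c + d\<rbrakk> \<Longrightarrow> {a, b} = {c, d}"
  shows "2 * card (B + B) = card B * (card B + 1)"
  using assms
proof (induction B)
  case (insert b B)
  have split: "insert b B + insert b B = (B + B) \<union> (+) b ` insert b B"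
    by (auto simp: set_plus_def add.commute)
  have "(B + B) \<inter> (+) b ` insert b B = {}"
  proof -
    have False if "x \<in> B" "y \<in> B" "z \<in> insert b B" "x + y = b + z" for x y z
      using insert.prems[of x y b z] that insert.hyps by (auto simp: doubleton_eq_iff)
    thus ?thesis by (fastforce simp: set_plus_def)
  qed
  hence "card (insert b B + insert b B) = card (B + B) + card ((+) b ` insert b B)"
    unfolding split using insert.hyps by (intro card_Un_disjoint) (auto simp: finite_set_plus)
  also have "card ((+) b ` insert b B) = card B + 1"
    using insert.hyps by (subst card_image) auto
  finally show ?case using insert.IH insert.prems insert.hyps by (simp add: algebra_simps)
qed (simp add: set_plus_def)

section \<open>Sets whose elements nearly double\<close>

text \<open>The only feature of two progressions with ratio at least 2 that the quadratic bound
  needs. Being free of indices, it passes to subsets, as the induction requires.\<close>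

definition thin :: "real set \<Rightarrow> bool" where
  "thin A \<longleftrightarrow> (\<forall>a\<in>A. \<forall>b\<in>A. \<forall>c\<in>A. a < b \<longrightarrow> b < c \<longrightarrow> 2 * a \<le> c)"

lemma thin_subset: "thin A \<Longrightarrow> B \<subseteq> A \<Longrightarrow> thin B"
  unfolding thin_def by blast

lemma two_largest_elementsE:
  fixes A :: "'a::linorder set"
  assumes "finite A" "card A \<ge> 2"
  obtains M M' where "M \<in> A" "M' \<in> A" "M' < M" "\<And>a. a \<in> A - {M, M'} \<Longrightarrow> a < M'"
proof -
  define M where "M = Max A"
  define M' where "M' = Max (A - {M})"
  have "A \<noteq> {}" using assms by auto
  hence M: "M \<in> A" "\<And>a. a \<in> A \<Longrightarrow> a \<le> M" using assms(1) by (auto simp: M_def)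
  have "card (A - {M}) \<noteq> 0" using assms M(1) by simp
  hence ne: "A - {M} \<noteq> {}" by (metis card.empty)
  have M': "M' \<in> A - {M}" unfolding M'_def using Max_in[OF _ ne] assms(1) by blast
  have "a < M'" if "a \<in> A - {M, M'}" for a
    using that assms(1) Max_ge[of "A - {M}" a] unfolding M'_def by fastforce
  moreover have "M' < M" using M' M(2)[of M'] by auto
  ultimately show thesis using that[of M M'] M M' by blast
qed

text \<open>Sums inside \<open>B\<close> are at most \<open>M\<close>, sums with \<open>M\<close>
  exceed it. The set \<open>S\<close> leaves room for further sums: it is empty in the induction and
  a singleton in the improvement for eight elements.\<close>

lemma card_sumset_remove_two:
  fixes A :: "real set"
  assumes fin: "finite A" and pos: "A \<subseteq> {0<..}"
    and M: "M \<in> A" and half: "\<And>a. a \<in> B \<Longrightarrow> 2 * a \<le> M" and B: "B \<subseteq> A"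
    and S: "S \<subseteq> A + A" "S \<inter> ((B + B) \<union> (+) M ` A) = {}"
  shows "card (B + B) + card A + card S \<le> card (A + A)"
proof -
  have finB: "finite B" using fin B finite_subset by blast
  have finS: "finite S" using S(1) fin finite_set_plus finite_subset by blast
  have "x + y \<noteq> M + a" if "x \<in> B" "y \<in> B" "a \<in> A" for x y a
    using half[OF that(1)] half[OF that(2)] pos that(3) by force
  hence "(B + B) \<inter> (+) M ` A = {}" by (fastforce simp: set_plus_def)
  hence "card ((B + B) \<union> (+) M ` A) = card (B + B) + card A"
    using fin finB by (subst card_Un_disjoint) (auto simp: finite_set_plus card_image)
  hence "card (((B + B) \<union> (+) M ` A) \<union> S) = card (B + B) + card A + card S"
    using fin finB finS S(2) by (subst card_Un_disjoint) (auto simp: finite_set_plus)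
  moreover have "((B + B) \<union> (+) M ` A) \<union> S \<subseteq> A + A"
    using S(1) M B by (auto simp: set_plus_def)
  hence "card (((B + B) \<union> (+) M ` A) \<union> S) \<le> card (A + A)"
    by (intro card_mono finite_set_plus fin)
  ultimately show ?thesis by simp
qed

text \<open>Since (k + 1)^2 - (k - 1)^2 = 4k, the \<open>card A\<close> sums gained by restoring the
  two largest elements are exactly what the bound asks for. The bound fails for fewer than two
  elements, so sets of two and three elements are treated directly, with 3 and 5 sums.\<close>

lemma card_sumset_thin:
  assumes "finite A" "A \<subseteq> {0<..}" "thin A" "card A \<ge> 2"
  shows "(card A + 1)\<^sup>2 + 3 \<le> 4 * card (A + A)"
  using assms
proof (induction "card A" arbitrary: A rule: less_induct)
  case less
  from two_largest_elementsE[OF less.prems(1,4)] obtain M M' where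
    M: "M \<in> A" "M' \<in> A" "M' < M" "\<And>a. a \<in> A - {M, M'} \<Longrightarrow> a < M'" by blast
  define B where "B = A - {M, M'}"
  have cardB: "card A = card B + 2"
    using M less.prems(1,4) by (simp add: B_def card_Diff_subset)
  have half: "2 * a \<le> M" if "a \<in> B" for a
    using less.prems(3) M that unfolding thin_def B_def by blast
  have B: "B \<subseteq> A" by (auto simp: B_def)
  have step: "card (B + B) + card A + card S \<le> card (A + A)"
    if "S \<subseteq> A + A" "S \<inter> ((B + B) \<union> (+) M ` A) = {}" for S
    using card_sumset_remove_two[OF less.prems(1,2) M(1) half B that] .
  consider "card B = 0" | "card B = 1" | "card B \<ge> 2" by linarith
  thus ?case
  proof cases
    case 1
    hence "B = {}" using less.prems(1) B finite_subset by fastforce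
    hence "A = {M, M'}" using M by (auto simp: B_def)
    moreover have "{2 * M', M + M', 2 * M} \<subseteq> {M, M'} + {M, M'}" by (auto simp: set_plus_def)
    hence "card {2 * M', M + M', 2 * M} \<le> card ({M, M'} + {M, M'})"
      by (intro card_mono) (auto simp: finite_set_plus)
    ultimately have "3 \<le> card (A + A)" using M(3) by simp
    thus ?thesis using 1 cardB by (simp add: power2_eq_square)
  next
    case 2
    then obtain a where "B = {a}" by (auto simp: card_1_singleton_iff)
    hence A: "A = {a, M', M}" and a: "a < M'" using M by (auto simp: B_def)
    have "{2 * a, a + M', 2 * M', M + M', 2 * M} \<subseteq> A + A" by (auto simp: A set_plus_def)
    hence "card {2 * a, a + M', 2 * M', M + M', 2 * M} \<le> card (A + A)"
      by (intro card_mono) (auto simp: finite_set_plus A)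
    moreover have "card {2 * a, a + M', 2 * M', M + M', 2 * M} = 5" using a M(3) by simp
    ultimately show ?thesis using 2 cardB by (simp add: power2_eq_square)
  next
    \<comment> \<open>All sums with \<open>M\<close> exceed \<open>M\<close>, while all sums inside \<open>B\<close> are at most \<open>M\<close>.\<close>
    case 3
    have "(card B + 1)\<^sup>2 + 3 \<le> 4 * card (B + B)"
    proof (rule less.hyps)
      show "finite B" using B less.prems(1) by (rule finite_subset)
      show "thin B" using less.prems(3) B by (rule thin_subset)
    qed (use 3 cardB B less.prems(2) in auto)
    with step[of "{}"] cardB show ?thesis by (simp add: power2_eq_square)
  qed
qed

lemma two_times_power_le:
  fixes r :: real
  assumes "r \<ge> 2" "x > 0" "r ^ i * x < r ^ j * x"
  shows "2 * (r ^ i * x) \<le> r ^ j * x"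
proof -
  have "r ^ i < r ^ j" using assms by simp
  hence "i < j" using assms(1) by (meson linorder_not_le power_increasing order_trans one_le_numeral)
  hence "r ^ Suc i \<le> r ^ j" using assms(1) by (intro power_increasing) auto
  moreover have "2 * r ^ i \<le> r * r ^ i" using assms(1) by (intro mult_right_mono) auto
  ultimately have "2 * r ^ i \<le> r ^ j" by simp
  hence "2 * r ^ i * x \<le> r ^ j * x" using assms(2) by (intro mult_right_mono) auto
  thus ?thesis by simp
qed

text \<open>Among three elements two lie in the same progression, where the larger is at least twice
  the smaller.\<close>

lemma thin_Un_geom:
  fixes r :: real
  assumes r: "r \<ge> 2" and "x > 0" "y > 0"
  shows "thin ((\<lambda>i. r ^ i * x) ` I \<union> (\<lambda>i. r ^ i * y) ` J)" (is "thin (?P \<union> ?Q)")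
proof -
  have *: "2 * a \<le> b" if "a < b" "a \<in> ?P \<and> b \<in> ?P \<or> a \<in> ?Q \<and> b \<in> ?Q" for a b
    using that two_times_power_le[OF r] assms(2,3) by auto
  show ?thesis unfolding thin_def
  proof (intro ballI impI)
    fix a b c assume abc: "a \<in> ?P \<union> ?Q" "b \<in> ?P \<union> ?Q" "c \<in> ?P \<union> ?Q" "a < b" "b < c"
    then consider "a \<in> ?P \<and> b \<in> ?P \<or> a \<in> ?Q \<and> b \<in> ?Q" | "b \<in> ?P \<and> c \<in> ?P \<or> b \<in> ?Q \<and> c \<in> ?Q"
      | "a \<in> ?P \<and> c \<in> ?P \<or> a \<in> ?Q \<and> c \<in> ?Q" by (elim UnE) metis+
    thus "2 * a \<le> c" using *[of a b] *[of b c] *[of a c] abc(4,5) by cases linarith+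
  qed
qed

text \<open>Both progressions are listed downwards from their tops \<open>M\<close> and
  \<open>q\<close>. If no new sum existed, every sum would lie in \<open>B + B\<close> or in
  \<open>M + A\<close>; this pins down \<open>q\<close> and the lengths, and a concrete sum then
  refutes each remaining configuration.\<close>

lemma doubling_pair_new_sum:
  fixes M q :: real and n m :: nat
  assumes q: "M / 2 < q" "q < M" and n: "n \<ge> 2" and m: "m \<ge> 2" and nm: "n + m = 8"
    and A: "A = (\<lambda>i. M / 2 ^ i) ` {..<n} \<union> (\<lambda>j. q / 2 ^ j) ` {..<m}"
    and B: "B = A - {M, q}"
  shows "\<exists>s \<in> A + A. s \<notin> (B + B) \<union> (+) M ` A"
proof (rule ccontr)
  assume "\<not> ?thesis"
  hence cover: "s \<in> B + B \<or> s - M \<in> A" if "s \<in> A + A" for s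
    using that by fastforce
  have M: "M > 0" using q by linarith
  have P: "M / 2 ^ i \<in> A" if "i < n" for i using that A by auto
  have Q: "q / 2 ^ i \<in> A" if "i < m" for i using that A by auto
  have pos: "a > 0" if "a \<in> A" for a using that M q unfolding A by auto
  have Bcases: "b = M / 2 \<or> b \<le> q / 2" if "b \<in> B" for b
  proof -
    from that consider i where "b = M / 2 ^ i" "b \<noteq> M" | i where "b = q / 2 ^ i" "b \<noteq> q"
      unfolding B A by auto
    thus ?thesis
    proof cases
      case 1
      hence "i \<noteq> 0" by (intro notI) auto
      then consider "i = 1" | "2 \<le> i" by linarith
      thus ?thesis
      proof cases
        assume "2 \<le> i"
        hence "(2::real) ^ 2 \<le> 2 ^ i" by (intro power_increasing) auto
        hence "M / 2 ^ i \<le> M / 4" using M by (intro divide_left_mono) auto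
        thus ?thesis using 1 q by linarith
      qed (use 1 in simp)
    next
      case 2
      hence "1 \<le> i" by (cases i) auto
      hence "(2::real) ^ 1 \<le> 2 ^ i" by (intro power_increasing) auto
      hence "q / 2 ^ i \<le> q / 2" using M q by (intro divide_left_mono) auto
      thus ?thesis using 2 by simp
    qed
  qed
  have BB: "s = M \<or> s \<le> M / 2 + q / 2" if s: "s \<in> B + B" for s
  proof -
    from s obtain b c where "s = b + c" "b \<in> B" "c \<in> B" by (auto simp: set_plus_def)
    with Bcases[of b] Bcases[of c] q show ?thesis by auto
  qed
  \<comment> \<open>The largest sum of \<open>B + B\<close> is \<open>M\<close>, and the next one is \<open>M / 2 + q / 2\<close>; this forces \<open>q\<close> to be
    \<open>2 M / 3\<close> or \<open>3 M / 4\<close>, and then \<open>(n, m)\<close> to be \<open>(2, 6)\<close> or \<open>(6, 2)\<close>.\<close>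
  have gap: False if "s \<in> A + A" "M / 2 + q / 2 < s" "s < M" for s
    using cover[OF that(1)] BB[of s] pos[of "s - M"] that by auto
  have qA: "q \<in> A" using Q[of 0] m by simp
  have q2A: "q / 2 \<in> A" using Q[of 1] m by simp
  have M2A: "M / 2 \<in> A" using P[of 1] n by simp
  have "q + M / 2 \<in> A + A" using qA M2A by (rule set_plus_intro)
  \<comment> \<open>The sum \<open>q + M / 2\<close> exceeds \<open>M\<close>, hence all of
    \<open>B + B\<close>, so it must have the form \<open>M + a\<close>.\<close>
  hence a: "q - M / 2 \<in> A" using cover[of "q + M / 2"] BB[of "q + M / 2"] q by auto
  have "3 * q / 2 \<ge> M"
  proof (rule ccontr)
    assume "\<not> ?thesis"
    moreover have "q + q / 2 \<in> A + A" using qA q2A by (rule set_plus_intro)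
    ultimately show False using gap[of "q + q / 2"] q by (auto simp: field_simps)
  qed
  then consider "q = 2 * M / 3" | "q > 2 * M / 3" by linarith
  thus False
  proof cases
    case 1
    have "n = 2"
    proof (rule ccontr)
      assume "n \<noteq> 2"
      hence "M / 2 ^ 2 \<in> A" using n by (intro P) auto
      hence "q + M / 4 \<in> A + A" using qA by (intro set_plus_intro) auto
      from gap[OF this] show False using 1 M by simp
    qed
    hence "m = 6" using nm by simp
    have set6: "{..<6} = {0, 1, 2, 3, 4, 5 :: nat}" "{..<2} = {0, 1 :: nat}" by auto
    have Bin: "b \<in> {M / 2, M / 3, M / 6, M / 12, M / 24, M / 48}" if "b \<in> B" for b
      using that unfolding B A \<open>n = 2\<close> \<open>m = 6\<close> set6 1 by auto
    \<comment> \<open>The witness is \<open>q + q / 8 = 3 * M / 4\<close>: it is below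
      \<open>M\<close>, and no two of the six elements of \<open>B\<close> add up to it.\<close>
    have "q / 2 ^ 3 \<in> A" using \<open>m = 6\<close> by (intro Q) auto
    hence "q + q / 2 ^ 3 \<in> A + A" using qA by (intro set_plus_intro) auto
    hence "3 * M / 4 \<in> A + A" using 1 by simp
    from cover[OF this] have "3 * M / 4 \<in> B + B" using pos[of "3 * M / 4 - M"] M by auto
    then obtain b c where bc: "b \<in> B" "c \<in> B" "b + c = 3 * M / 4" by (auto simp: set_plus_def)
    from Bin[OF bc(1)] Bin[OF bc(2)] bc(3) M show False
      unfolding insert_iff empty_iff by (elim disjE) simp_all
  next
    case 2
    \<comment> \<open>With \<open>q > 2 * M / 3\<close>, the element \<open>q - M / 2\<close> of
      \<open>A\<close> lies strictly between \<open>M / 6\<close> and \<open>M / 2\<close>. A value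
      \<open>q / 2 ^ i\<close> would force \<open>q \<ge> M\<close> or
      \<open>q \<le> 2 * M / 3\<close>, so only \<open>M / 4\<close> remains.\<close>
    have q34: "q = 3 * M / 4"
    proof -
      from a consider i where "q - M / 2 = M / 2 ^ i" | i where "q - M / 2 = q / 2 ^ i"
        unfolding A by auto
      thus ?thesis
      proof cases
        case i: 1
        consider "i = 0" | "i = 1" | "i = 2" | "3 \<le> i" by linarith
        thus ?thesis
        proof cases
          assume "3 \<le> i"
          hence "(2::real) ^ 3 \<le> 2 ^ i" by (intro power_increasing) auto
          hence "M / 2 ^ i \<le> M / 8" using M by (intro divide_left_mono) auto
          thus ?thesis using 2 i M by linarith
        qed (use i q M in simp_all)
      next
        case i: 2
        consider "i = 0" | "i = 1" | "2 \<le> i" by linarith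
        thus ?thesis
        proof cases
          assume "2 \<le> i"
          hence "(2::real) ^ 2 \<le> 2 ^ i" by (intro power_increasing) auto
          hence "q / 2 ^ i \<le> q / 4" using M q by (intro divide_left_mono) auto
          thus ?thesis using 2 i M by linarith
        qed (use i q M in simp_all)
      qed
    qed
    have "m = 2"
    proof (rule ccontr)
      assume "m \<noteq> 2"
      hence "q / 2 ^ 2 \<in> A" using m by (intro Q) auto
      hence "q + q / 4 \<in> A + A" using qA by (intro set_plus_intro) auto
      from gap[OF this] show False using q34 M by simp
    qed
    hence "n = 6" using nm by simp
    have set6: "{..<6} = {0, 1, 2, 3, 4, 5 :: nat}" "{..<2} = {0, 1 :: nat}" by auto
    have Bin: "b \<in> {M / 2, M / 4, M / 8, M / 16, M / 32, 3 * M / 8}" if "b \<in> B" for b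
      using that unfolding B A \<open>n = 6\<close> \<open>m = 2\<close> set6 q34 by auto
    \<comment> \<open>Here the witness is \<open>q + M / 16 = 13 * M / 16\<close>.\<close>
    have "M / 2 ^ 4 \<in> A" using \<open>n = 6\<close> by (intro P) auto
    hence "q + M / 2 ^ 4 \<in> A + A" using qA by (intro set_plus_intro) auto
    hence "13 * M / 16 \<in> A + A" using q34 by simp
    from cover[OF this] have "13 * M / 16 \<in> B + B" using pos[of "13 * M / 16 - M"] M by auto
    then obtain b c where bc: "b \<in> B" "c \<in> B" "b + c = 13 * M / 16" by (auto simp: set_plus_def)
    from Bin[OF bc(1)] Bin[OF bc(2)] bc(3) M show False
      unfolding insert_iff empty_iff by (elim disjE) simp_all
  qed
qed

section \<open>Coincidences between two progressions\<close>

abbreviation geom :: "real \<Rightarrow> real \<Rightarrow> nat \<Rightarrow> real set" where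
  "geom r x n \<equiv> (\<lambda>i. r ^ i * x) ` {..<n}"

lemma inj_powers:
  fixes r x :: real
  assumes "r > 1" "x > 0"
  shows "inj (\<lambda>i. r ^ i * x)"
  using assms by (auto intro!: injI)

lemma card_geom:
  assumes "r > 1" "x > 0"
  shows "card (geom r x n) = n"
  using inj_powers[OF assms] by (subst card_image) (auto intro: inj_on_subset)

lemma card_sumset_powers:
  fixes r x :: real
  assumes r: "r \<in> \<rat>" "r > 1" and x: "x > 0" and B: "finite B" "B \<subseteq> range (\<lambda>i::nat. r ^ i * x)"
  shows "2 * card (B + B) = card B * (card B + 1)"
proof (rule card_sumset_Sidon[OF B(1)])
  fix a b c d assume "a \<in> B" "b \<in> B" "c \<in> B" "d \<in> B" and eq: "a + b = c + d"
  with B(2) obtain i j k l where ij: "a = r ^ i * x" "b = r ^ j * x" "c = r ^ k * x" "d = r ^ l * x"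
    by (meson rangeE subsetD)
  have "(r ^ i + r ^ j) * x = (r ^ k + r ^ l) * x" using eq ij by (simp add: algebra_simps)
  hence "{#i, j#} = {#k, l#}" using x r by (intro sum_two_powers_unique) auto
  hence "i = k \<and> j = l \<or> i = l \<and> j = k" by (auto simp: add_eq_conv_ex)
  with ij show "{a, b} = {c, d}" by auto
qed

lemma card_sumset_geom:
  assumes "r \<in> \<rat>" "r > 1" "x > 0"
  shows "2 * card (geom r x n + geom r x n) = n * (n + 1)"
  using card_sumset_powers[OF assms, of "geom r x n"] card_geom[OF assms(2,3)]
  by (simp add: image_mono)

text \<open>If all coincidences are translates of one, two of their indices keep a constant
  difference; both fit below \<open>n\<close> only in \<open>n - \<bar>\<delta>\<bar>\<close>
  positions.\<close>

lemma card_le_translates: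
  fixes g :: "nat \<Rightarrow> 'a" and \<delta> :: int
  assumes "\<And>s. s \<in> S \<Longrightarrow> \<exists>i<n. \<exists>k<n. int k - int i = \<delta> \<and> s = g i"
  shows "card S \<le> n - nat \<bar>\<delta>\<bar>"
proof (cases "\<delta> \<ge> 0")
  case True
  have "S \<subseteq> g ` {..<n - nat \<bar>\<delta>\<bar>}" using assms True by fastforce
  hence "card S \<le> card (g ` {..<n - nat \<bar>\<delta>\<bar>})" by (intro card_mono) auto
  also have "\<dots> \<le> n - nat \<bar>\<delta>\<bar>" using card_image_le[of "{..<n - nat \<bar>\<delta>\<bar>}" g] by simp
  finally show ?thesis .
next
  case False
  let ?h = "\<lambda>k. g (k + nat \<bar>\<delta>\<bar>)"
  have "S \<subseteq> ?h ` {..<n - nat \<bar>\<delta>\<bar>}"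
  proof
    fix s assume "s \<in> S"
    then obtain i k where ik: "i < n" "int k - int i = \<delta>" "s = g i" using assms by blast
    hence "i = k + nat \<bar>\<delta>\<bar>" using False by linarith
    with ik show "s \<in> ?h ` {..<n - nat \<bar>\<delta>\<bar>}" by (intro image_eqI[of _ _ k]) auto
  qed
  hence "card S \<le> card (?h ` {..<n - nat \<bar>\<delta>\<bar>})" by (intro card_mono) auto
  also have "\<dots> \<le> n - nat \<bar>\<delta>\<bar>" using card_image_le[of "{..<n - nat \<bar>\<delta>\<bar>}" ?h] by simp
  finally show ?thesis .
qed

lemma power_combination_shift:
  fixes r u v :: real
  assumes "r > 1" "s = r ^ a * u + r ^ b * v" "s0 = r ^ a0 * u + r ^ b0 * v"
    and "a + c0 = a0 + c" "b + c0 = b0 + c"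
  shows "s = s0 * r ^ c / r ^ c0"
proof -
  have "r ^ a * r ^ c0 = r ^ a0 * r ^ c" "r ^ b * r ^ c0 = r ^ b0 * r ^ c"
    using assms by (simp_all flip: power_add)
  hence "(r ^ a * r ^ c0) * u + (r ^ b * r ^ c0) * v = (r ^ a0 * r ^ c) * u + (r ^ b0 * r ^ c) * v"
    by simp
  thus ?thesis using assms(1-3) by (simp add: eq_divide_eq algebra_simps)
qed

text \<open>Bonferroni's inequality, arranged without subtraction of natural numbers.\<close>

lemma card_Un3_ge:
  assumes "finite X" "finite Y" "finite Z"
  shows "card X + card Y + card Z \<le>
    card (X \<union> Y \<union> Z) + card (X \<inter> Y) + card (X \<inter> Z) + card (Y \<inter> Z)"
proof -
  have "card ((X \<union> Y) \<inter> Z) \<le> card (X \<inter> Z) + card (Y \<inter> Z)"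
    unfolding Int_Un_distrib2 by (rule card_Un_le)
  moreover have "card X + card Y = card (X \<union> Y) + card (X \<inter> Y)"
    using assms by (intro card_Un_Int) auto
  moreover have "card (X \<union> Y) + card Z = card (X \<union> Y \<union> Z) + card ((X \<union> Y) \<inter> Z)"
    using assms by (intro card_Un_Int) auto
  ultimately show ?thesis by linarith
qed

text \<open>With exponents on both sides, \<open>incomm\<close> says that \<open>x / y\<close> is no
  integer power of \<open>r\<close>, negative powers included.\<close>

locale incommensurable_progressions =
  fixes r x y :: real
  assumes r: "r \<in> \<rat>" "r > 1" "r \<noteq> 2" and x: "x > 0" and y: "y > 0"
    and incomm: "r ^ i * x \<noteq> r ^ j * y"
begin

lemma swap: "incommensurable_progressions r y x"
  using r x y incomm by unfold_locales metis+

text \<open>Eliminating \<open>x\<close> and \<open>y\<close> between a coincidence and a fixed one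
  yields an identity of three powers on each side, so all coincidences are translates of the fixed
  one. Incommensurability gives \<open>i0 \<noteq> k0\<close>, which saves one of the
  \<open>n\<close> positions.\<close>

lemma card_self_Int_mixed_sums:
  "card ((geom r x n + geom r x n) \<inter> (geom r x n + geom r y m)) \<le> min (n - 1) m"
    (is "card ?S \<le> _")
proof (cases "?S = {}")
  case False
  define rep where "rep s i j k l \<longleftrightarrow> i < n \<and> j < n \<and> k < n \<and> l < m \<and>
    s = r ^ i * x + r ^ j * x \<and> s = r ^ k * x + r ^ l * y" for s i j k l
  have rep_ex: "\<exists>i j k l. rep s i j k l" if "s \<in> ?S" for s
    using that unfolding rep_def set_plus_def by fast
  from False rep_ex obtain s0 i0 j0 k0 l0 where rep0: "rep s0 i0 j0 k0 l0" by blast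
  have ne: "i \<noteq> k \<and> j \<noteq> k" if "rep s i j k l" for s i j k l
    using that incomm unfolding rep_def by (auto simp: add.commute)
  have shift: "\<exists>i k l. i < n \<and> k < n \<and> l < m \<and> int i - int k = int i0 - int k0 \<and>
    s = s0 * r ^ k / r ^ k0 \<and> s = s0 * r ^ l / r ^ l0" if s: "s \<in> ?S" for s
  proof -
    from rep_ex[OF s] obtain i j k l where rep: "rep s i j k l" by blast
    have eq: "(r ^ i + r ^ j - r ^ k) * x = r ^ l * y" "(r ^ i0 + r ^ j0 - r ^ k0) * x = r ^ l0 * y"
      using rep rep0 by (simp_all add: rep_def algebra_simps)
    have "((r ^ i + r ^ j - r ^ k) * r ^ l0) * x = ((r ^ i + r ^ j - r ^ k) * x) * r ^ l0"
      by (simp only: mult_ac)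
    also have "\<dots> = (r ^ l0 * y) * r ^ l" unfolding eq(1) by (simp only: mult_ac)
    also have "\<dots> = ((r ^ i0 + r ^ j0 - r ^ k0) * r ^ l) * x"
      unfolding eq(2)[symmetric] by (simp only: mult_ac)
    finally have "(r ^ i + r ^ j - r ^ k) * r ^ l0 = (r ^ i0 + r ^ j0 - r ^ k0) * r ^ l"
      using x by simp
    hence "r ^ (i + l0) + r ^ (j + l0) + r ^ (k0 + l) = r ^ (i0 + l) + r ^ (j0 + l) + r ^ (k + l0)"
      by (simp add: algebra_simps power_add)
    from sum_three_powers_unique[OF r this]
    have ms: "{#i + l0, j + l0, k0 + l#} = {#i0 + l, j0 + l, k + l0#}" .
    \<comment> \<open>By \<open>ne\<close>, \<open>k\<close> differs from \<open>i\<close> and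
      \<open>j\<close>, so \<open>k + l0\<close> can only match \<open>k0 + l\<close>; likewise
      \<open>i0 + l\<close> cannot match \<open>k0 + l\<close>.\<close>
    have "k + l0 \<in># {#i + l0, j + l0, k0 + l#}" by (simp add: ms)
    hence k: "k + l0 = k0 + l" using ne[OF rep] by auto
    have "i0 + l \<in># {#i + l0, j + l0, k0 + l#}" by (simp add: ms)
    hence i: "i0 + l = i + l0 \<or> i0 + l = j + l0" using ne[OF rep0] by auto
    have "s = s0 * r ^ k / r ^ k0" "s = s0 * r ^ l / r ^ l0"
      by (rule power_combination_shift[of r s k x l y s0 k0 l0]; use r rep rep0 k in \<open>simp add: rep_def\<close>)+
    moreover from i k rep have "\<exists>i<n. int i - int k = int i0 - int k0" unfolding rep_def
      by (elim disjE) (rule exI[of _ i] exI[of _ j], simp)+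
    ultimately show ?thesis using rep unfolding rep_def by blast
  qed
  have "card ?S \<le> n - nat \<bar>int i0 - int k0\<bar>"
    by (rule card_le_translates[where g = "\<lambda>k. s0 * r ^ k / r ^ k0"]) (use shift in blast)
  \<comment> \<open>Offset 0 uses only that the index \<open>l\<close> determines the sum.\<close>
  moreover have "card ?S \<le> m - nat \<bar>0\<bar>"
    by (rule card_le_translates[where g = "\<lambda>l. s0 * r ^ l / r ^ l0"]) (use shift in fastforce)
  ultimately show ?thesis using ne[OF rep0] by auto
qed auto

text \<open>Cross-multiplying with a fixed coincidence gives equal products of power sums, so again
  all coincidences are translates. The gaps \<open>j0 - i0\<close> and \<open>l0 - k0\<close>
  differ, since equal gaps would make the progressions commensurable; so for \<open>n = m\<close> at
  least one position is lost.\<close>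

lemma card_self_Int_self_sums:
  "card ((geom r x n + geom r x n) \<inter> (geom r y m + geom r y m)) \<le> (if n = m then n - 1 else min n m)"
    (is "card ?S \<le> _")
proof (cases "?S = {}")
  case False
  define rep where "rep s i j k l \<longleftrightarrow> i \<le> j \<and> j < n \<and> k \<le> l \<and> l < m \<and>
    s = r ^ i * x + r ^ j * x \<and> s = r ^ k * y + r ^ l * y" for s i j k l
  have ordered: "\<exists>i j. i \<le> j \<and> j < n \<and> s = r ^ i * x + r ^ j * x"
    if s: "s \<in> geom r x n + geom r x n" for s x n
  proof -
    from s obtain i j where "i < n" "j < n" "s = r ^ i * x + r ^ j * x"
      by (auto simp: set_plus_def)
    thus ?thesis by (metis add.commute linorder_linear)
  qed
  have rep_ex: "\<exists>i j k l. rep s i j k l" if "s \<in> ?S" for s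
    using that ordered[of s x n] ordered[of s y m] unfolding rep_def by blast
  from False rep_ex obtain s0 i0 j0 k0 l0 where rep0: "rep s0 i0 j0 k0 l0" by blast
  have ne: "j0 + k0 \<noteq> i0 + l0"
  proof
    assume *: "j0 + k0 = i0 + l0"
    define a where "a = j0 - i0"
    have "j0 = i0 + a" "l0 = k0 + a" using * rep0 by (auto simp: a_def rep_def)
    hence "(1 + r ^ a) * (r ^ i0 * x) = (1 + r ^ a) * (r ^ k0 * y)"
      using rep0 by (simp add: rep_def algebra_simps power_add)
    moreover have "1 + r ^ a > 0" using r by (simp add: add_pos_pos)
    ultimately show False using incomm[of i0 k0] by simp
  qed
  have shift: "\<exists>i j k l. i < n \<and> j < n \<and> k < m \<and> l < m \<and> int j - int i = int j0 - int i0 \<and>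
    int l - int k = int l0 - int k0 \<and>
    s = s0 * r ^ i / r ^ i0 \<and> s = s0 * r ^ k / r ^ k0" if s: "s \<in> ?S" for s
  proof -
    from rep_ex[OF s] obtain i j k l where rep: "rep s i j k l" by blast
    have eq: "(r ^ i + r ^ j) * x = (r ^ k + r ^ l) * y" "(r ^ i0 + r ^ j0) * x = (r ^ k0 + r ^ l0) * y"
      using rep rep0 by (simp_all add: rep_def algebra_simps)
    have "((r ^ i + r ^ j) * (r ^ k0 + r ^ l0)) * (x * y) =
          ((r ^ i + r ^ j) * x) * ((r ^ k0 + r ^ l0) * y)" by (simp only: mult_ac)
    also have "\<dots> = ((r ^ k + r ^ l) * y) * ((r ^ i0 + r ^ j0) * x)" by (simp only: eq)
    also have "\<dots> = ((r ^ i0 + r ^ j0) * (r ^ k + r ^ l)) * (x * y)" by (simp only: mult_ac)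
    finally have "(r ^ i + r ^ j) * (r ^ k0 + r ^ l0) = (r ^ i0 + r ^ j0) * (r ^ k + r ^ l)"
      using x y by simp
    from product_of_power_sums_unique[OF r this]
    have ms: "{#i + k0, i + l0, j + k0, j + l0#} = {#i0 + k, i0 + l, j0 + k, j0 + l#}" .
    have le: "i \<le> j" "k \<le> l" "i0 \<le> j0" "k0 \<le> l0" using rep rep0 by (auto simp: rep_def)
    have "i + k0 \<in># {#i0 + k, i0 + l, j0 + k, j0 + l#}"
      "i0 + k \<in># {#i + k0, i + l0, j + k0, j + l0#}" by (simp flip: ms, simp add: ms)
    hence lo: "i + k0 = i0 + k" using le by auto
    have "j + l0 \<in># {#i0 + k, i0 + l, j0 + k, j0 + l#}"
      "j0 + l \<in># {#i + k0, i + l0, j + k0, j + l0#}" by (simp flip: ms, simp add: ms)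
    hence hi: "j + l0 = j0 + l" using le by auto
    \<comment> \<open>The extreme exponents are matched. Crossing the middle pair would make the two
      gaps equal, against \<open>ne\<close>.\<close>
    from ms have "{#i + l0, j + k0#} = {#i0 + l, j0 + k#}"
      using lo hi by (simp add: add_mset_commute)
    hence "i + l0 = i0 + l \<and> j + k0 = j0 + k \<or> i + l0 = j0 + k \<and> j + k0 = i0 + l"
      by (auto simp: add_eq_conv_ex)
    hence mid: "i + l0 = i0 + l \<and> j + k0 = j0 + k" using lo hi ne by linarith
    have "s = s0 * r ^ i / r ^ i0"
      by (rule power_combination_shift[of r s i x j x s0 i0 j0]; use r rep rep0 lo mid in \<open>simp add: rep_def\<close>)
    moreover have "s = s0 * r ^ k / r ^ k0"
      by (rule power_combination_shift[of r s k y l y s0 k0 l0]; use r rep rep0 lo mid in \<open>simp add: rep_def\<close>)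
    moreover have "int j - int i = int j0 - int i0" "int l - int k = int l0 - int k0"
      using lo mid by linarith+
    moreover have "i < n" "j < n" "k < m" "l < m" using rep by (auto simp: rep_def)
    ultimately show ?thesis by blast
  qed
  have "card ?S \<le> n - nat \<bar>int j0 - int i0\<bar>"
    by (rule card_le_translates[where g = "\<lambda>i. s0 * r ^ i / r ^ i0"]) (use shift in blast)
  moreover have "card ?S \<le> m - nat \<bar>int l0 - int k0\<bar>"
    by (rule card_le_translates[where g = "\<lambda>l. s0 * r ^ l / r ^ k0"]) (use shift in blast)
  ultimately show ?thesis using ne rep0 unfolding rep_def by auto
qed auto

text \<open>A coincidence rearranges to an equation between power differences, and comparison with a
  fixed one shows that the steps \<open>i' - i\<close> and \<open>j - j'\<close> are the same for
  all. Both steps are positive and they are distinct, so for \<open>n = m\<close> one of them is at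
  least 2.\<close>

lemma card_mixed_sums_ge:
  "n * m \<le> card (geom r x n + geom r y m) + (if n = m then n - 2 else min (n - 1) (m - 1))"
proof -
  define f where "f = (\<lambda>(i::nat, j::nat). r ^ i * x + r ^ j * y)"
  define rep where "rep i i' j j' \<longleftrightarrow> i < i' \<and> i' < n \<and> j' < m \<and> j < m \<and> f (i, j) = f (i', j')"
    for i i' j j'
  \<comment> \<open>Discarding the pairs in \<open>R\<close>, whose sum recurs with a larger first exponent, leaves one pair per sum.\<close>
  define R where "R = {(i, j). \<exists>i' j'. rep i i' j j'}"
  have less: "j' < j" if "rep i i' j j'" for i i' j j'
  proof (rule ccontr)
    assume "\<not> j' < j"
    hence "r ^ j * y \<le> r ^ j' * y" using r y by simp
    moreover have "r ^ i * x < r ^ i' * x" using that r x by (simp add: rep_def)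
    ultimately show False using that unfolding rep_def f_def by simp
  qed
  have eq: "r ^ i * (r ^ (i' - i) - 1) * x = r ^ j' * (r ^ (j - j') - 1) * y"
    if "rep i i' j j'" for i i' j j'
  proof -
    have "r ^ i' = r ^ i * r ^ (i' - i)" "r ^ j = r ^ j' * r ^ (j - j')"
      using that less[OF that] by (simp_all add: rep_def flip: power_add)
    with that show ?thesis unfolding rep_def f_def by (simp add: algebra_simps)
  qed
  have ne: "i' - i \<noteq> j - j'" if rep: "rep i i' j j'" for i i' j j'
  proof
    assume *: "i' - i = j - j'"
    have "r ^ (j - j') > 1" using less[OF rep] r by simp
    hence "r ^ i * x = r ^ j' * y" using eq[OF rep] unfolding * by simp
    with incomm show False by blast
  qed
  have R_card: "card R \<le> (if n = m then n - 2 else min (n - 1) (m - 1))"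
  proof (cases "R = {}")
    case False
    then obtain u u' v v' where rep0: "rep u u' v v'" by (auto simp: R_def)
    have shift: "i + v' = u + j' \<and> i' - i = u' - u \<and> j - j' = v - v'"
      if rep: "rep i i' j j'" for i i' j j'
    proof -
      let ?X = "\<lambda>i i'. r ^ i * (r ^ (i' - i) - 1)"
      have "(?X i i' * ?X v' v) * (x * y) = (?X i i' * x) * (?X v' v * y)" by (simp only: mult_ac)
      also have "\<dots> = (?X j' j * y) * (?X u u' * x)" by (simp only: eq[OF rep] eq[OF rep0])
      also have "\<dots> = (?X u u' * ?X j' j) * (x * y)" by (simp only: mult_ac)
      finally have "?X i i' * ?X v' v = ?X u u' * ?X j' j" using x y by simp
      hence "r ^ (i + v') * (r ^ (i' - i) - 1) * (r ^ (v - v') - 1) =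
             r ^ (u + j') * (r ^ (u' - u) - 1) * (r ^ (j - j') - 1)"
        by (simp only: power_add mult_ac)
      from product_of_power_differences_unique[OF r _ _ _ _ _ this]
      show ?thesis using less[OF rep] less[OF rep0] rep rep0 ne[OF rep] unfolding rep_def by simp
    qed
    have "card R \<le> n - nat \<bar>int u' - int u\<bar>"
    proof (rule card_le_translates[where g = "\<lambda>i. (i, nat (int i + int v - int u))"])
      fix s assume "s \<in> R"
      then obtain i i' j j' where s: "s = (i, j)" and rep: "rep i i' j j'" by (auto simp: R_def)
      show "\<exists>i<n. \<exists>k<n. int k - int i = int u' - int u \<and> s = (i, nat (int i + int v - int u))"
        using s rep rep0 shift[OF rep] less[OF rep] less[OF rep0] unfolding rep_def
        by (intro exI[of _ i] conjI exI[of _ i']) auto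
    qed
    moreover have "card R \<le> m - nat \<bar>int v' - int v\<bar>"
    proof (rule card_le_translates[where g = "\<lambda>j. (nat (int j + int u - int v), j)"])
      fix s assume "s \<in> R"
      then obtain i i' j j' where s: "s = (i, j)" and rep: "rep i i' j j'" by (auto simp: R_def)
      show "\<exists>j<m. \<exists>k<m. int k - int j = int v' - int v \<and> s = (nat (int j + int u - int v), j)"
        using s rep rep0 shift[OF rep] less[OF rep] less[OF rep0] unfolding rep_def
        by (intro exI[of _ j] conjI exI[of _ j']) auto
    qed
    moreover have "u < u'" "v' < v" "u' - u \<noteq> v - v'"
      using rep0 less[OF rep0] ne[OF rep0] by (auto simp: rep_def)
    ultimately show ?thesis by (auto simp: min_def)
  qed auto
  let ?G = "{..<n} \<times> {..<m}"
  have "inj_on f (?G - R)"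
  proof (rule inj_onI)
    fix a b assume "a \<in> ?G - R" "b \<in> ?G - R" "f a = f b"
    then obtain i j i' j' where ab: "a = (i, j)" "b = (i', j')"
      and lt: "i < n" "i' < n" "j < m" "j' < m" and f: "f (i, j) = f (i', j')"
      and notR: "(i, j) \<notin> R" "(i', j') \<notin> R" by auto
    have "\<not> i < i'" using notR(1) lt f unfolding R_def rep_def by blast
    moreover have "\<not> i' < i" using notR(2) lt f[symmetric] unfolding R_def rep_def by blast
    ultimately have "i = i'" by simp
    moreover from this have "j = j'" using f r y by (simp add: f_def)
    ultimately show "a = b" using ab by simp
  qed
  hence "card (f ` (?G - R)) = card (?G - R)" by (rule card_image)
  moreover have "f ` (?G - R) \<subseteq> geom r x n + geom r y m"
    by (auto simp: f_def intro!: set_plus_intro)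
  hence "card (f ` (?G - R)) \<le> card (geom r x n + geom r y m)"
    by (intro card_mono finite_set_plus) auto
  moreover have "R \<subseteq> ?G" by (auto simp: R_def rep_def)
  hence "card (?G - R) = n * m - card R"
    by (subst card_Diff_subset) (auto intro: finite_subset)
  ultimately show ?thesis using R_card by linarith
qed

text \<open>Counted with repetition there are \<open>k * (k + 1) / 2\<close> sums, and the four
  kinds of coincidence cost at most \<open>2 * k - 4\<close>, or \<open>2 * k - 5\<close> for even
  \<open>k\<close>.\<close>

lemma card_sumset_incommensurable:
  assumes n: "n \<ge> 1" and m: "m \<ge> 1" and k: "n + m = k" "k \<ge> 3"
  defines "A \<equiv> geom r x n \<union> geom r y m"
  shows "k\<^sup>2 + (if even k then 10 else 8) \<le> 2 * card (A + A) + 3 * k"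
proof -
  interpret s: incommensurable_progressions r y x by (rule swap)
  let ?P = "geom r x n" and ?Q = "geom r y m"
  define L1 L2 L3 where "L1 = card ((?P + ?P) \<inter> (?P + ?Q))" and "L2 = card ((?Q + ?Q) \<inter> (?P + ?Q))"
    and "L3 = card ((?P + ?P) \<inter> (?Q + ?Q))"
  have "A + A = (?P + ?P) \<union> (?Q + ?Q) \<union> (?P + ?Q)"
  proof
    show "A + A \<subseteq> (?P + ?P) \<union> (?Q + ?Q) \<union> (?P + ?Q)"
      unfolding A_def by (auto simp: set_plus_def Bex_def) (metis add.commute)+
    show "(?P + ?P) \<union> (?Q + ?Q) \<union> (?P + ?Q) \<subseteq> A + A"
      unfolding A_def by (intro Un_least set_plus_mono2) auto
  qed
  hence tot: "card (?P + ?P) + card (?Q + ?Q) + card (?P + ?Q) \<le> card (A + A) + L3 + L1 + L2"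
    using card_Un3_ge[of "?P + ?P" "?Q + ?Q" "?P + ?Q"] unfolding L1_def L2_def L3_def
    by (simp add: finite_set_plus)
  have PP: "2 * card (?P + ?P) = n * (n + 1)" "2 * card (?Q + ?Q) = m * (m + 1)"
    using card_sumset_geom r x y by blast+
  \<comment> \<open>Even \<open>k\<close> saves one more coincidence: unequal lengths differ by at
    least 2, and equal lengths have the sharper bounds for \<open>n = m\<close>.\<close>
  have par: "n + 2 \<le> m \<or> m + 2 \<le> n" if "even k" "n \<noteq> m" using that k(1) by presburger
  have "L1 \<le> min (n - 1) m" "L3 \<le> (if n = m then n - 1 else min n m)"
    unfolding L1_def L3_def by (rule card_self_Int_mixed_sums card_self_Int_self_sums)+
  moreover have "L2 \<le> min (m - 1) n"
    using s.card_self_Int_mixed_sums[of m n] unfolding L2_def by (simp add: add.commute)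
  moreover define L4 where "L4 = (if n = m then n - 2 else min (n - 1) (m - 1))"
  ultimately have L: "L1 + L2 + L3 + L4 + (if even k then 5 else 4) \<le> 2 * k"
    using n m k par by (cases n m rule: linorder_cases) (auto split: if_splits)
  have "n * m \<le> card (?P + ?Q) + L4" unfolding L4_def by (rule card_mixed_sums_ge)
  with tot have "n * (n + 1) + m * (m + 1) + 2 * (n * m) \<le> 2 * card (A + A) + 2 * (L1 + L2 + L3 + L4)"
    unfolding PP[symmetric] by simp
  moreover have "n * (n + 1) + m * (m + 1) + 2 * (n * m) = k\<^sup>2 + k"
    unfolding k(1)[symmetric] by (simp add: algebra_simps power2_eq_square)
  ultimately show ?thesis using L by (simp split: if_splits)
qed

end

section \<open>The four bounds\<close>

lemma geom_from_top:
  assumes "n \<ge> 1"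
  shows "geom 2 x n = (\<lambda>i. (2 ^ (n - 1) * x) / 2 ^ i) ` {..<n}"
proof -
  have "2 ^ i * x = (2 ^ (n - 1) * x) / 2 ^ (n - 1 - i)" if "i < n" for i
  proof -
    have "(2::real) ^ (n - 1) = 2 ^ i * 2 ^ (n - 1 - i)" using that by (simp flip: power_add)
    thus ?thesis by simp
  qed
  hence "geom 2 x n = (\<lambda>i. (2 ^ (n - 1) * x) / 2 ^ i) ` (\<lambda>i. n - 1 - i) ` {..<n}"
    unfolding image_image by (intro image_cong refl) blast
  also have "(\<lambda>i. n - 1 - i) ` {..<n} = {..<n}"
  proof
    show "{..<n} \<subseteq> (\<lambda>i. n - 1 - i) ` {..<n}"
    proof
      fix i assume "i \<in> {..<n}"
      thus "i \<in> (\<lambda>i. n - 1 - i) ` {..<n}" by (intro image_eqI[of _ _ "n - 1 - i"]) auto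
    qed
  qed (use assms in auto)
  finally show ?thesis .
qed

text \<open>Removing two elements leaves six with at least 13 sums, and 13 + 8 = 21, so one new sum
  suffices. If \<open>2 * M' \<le> M\<close>, then \<open>2 * M'\<close> is new; otherwise
  \<open>M\<close> and \<open>M'\<close> are the tops of different progressions.\<close>

lemma card_sumset_doubling_eight:
  assumes x: "x > 0" and y: "y > 0" and A: "A = geom 2 x n \<union> geom 2 y m" and card: "card A = 8"
  shows "22 \<le> card (A + A)"
proof -
  have fin: "finite A" and pos: "A \<subseteq> {0<..}" using x y by (auto simp: A)
  have thin: "thin A" unfolding A by (rule thin_Un_geom) (use x y in auto)
  from two_largest_elementsE[of A] fin card obtain M M' where
    M: "M \<in> A" "M' \<in> A" "M' < M" "\<And>a. a \<in> A - {M, M'} \<Longrightarrow> a < M'" by auto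
  define B where "B = A - {M, M'}"
  have B: "B \<subseteq> A" by (auto simp: B_def)
  have half: "2 * a \<le> M" if "a \<in> B" for a
    using thin M that unfolding thin_def B_def by blast
  have le_M: "a \<le> M" if "a \<in> A" for a using that M by force
  have cardB: "card B = 6" using M fin card by (simp add: B_def card_Diff_subset)
  have "(card B + 1)\<^sup>2 + 3 \<le> 4 * card (B + B)"
    by (rule card_sumset_thin) (use B fin pos thin thin_subset finite_subset cardB in \<open>auto simp: B_def\<close>)
  hence BB: "13 \<le> card (B + B)" by (simp add: cardB)
  have new: "22 \<le> card (A + A)" if "s \<in> A + A" "s \<notin> (B + B) \<union> (+) M ` A" for s
    using card_sumset_remove_two[OF fin pos M(1) half B, of "{s}"] that BB card by simp
  have factor: "2 * M' \<le> M" if "M \<in> geom 2 z l" "M' \<in> geom 2 z l" "z > 0" for z l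
    using that M(3) two_times_power_le[of 2 z] by auto
  have distinct_tops: "22 \<le> card (A + A)"
    if gt: "M < 2 * M'" and xy: "x > 0" "y > 0" and A: "A = geom 2 x n \<union> geom 2 y m"
      and MP: "M \<in> geom 2 x n" and MQ: "M' \<in> geom 2 y m" for x y n m
  proof -
    from MP obtain i where i: "i < n" "M = 2 ^ i * x" by auto
    from MQ obtain j where j: "j < m" "M' = 2 ^ j * y" by auto
    have "\<not> Suc i < n"
    proof
      assume "Suc i < n"
      hence "2 ^ Suc i * x \<in> A" unfolding A by blast
      from le_M[OF this] i xy show False by simp
    qed
    hence in1: "i = n - 1" "n \<ge> 1" using i by auto
    have "\<not> Suc j < m"
    proof
      assume "Suc j < m"
      hence "2 ^ Suc j * y \<in> A" unfolding A by blast
      from le_M[OF this] j gt show False by simp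
    qed
    hence jm: "j = m - 1" "m \<ge> 1" using j by auto
    have tops: "geom 2 x n = (\<lambda>i. M / 2 ^ i) ` {..<n}" "geom 2 y m = (\<lambda>i. M' / 2 ^ i) ` {..<m}"
      using geom_from_top[of n x] geom_from_top[of m y] in1 jm i j by auto
    have M0: "M' > 0" "M > 0" using pos M(1,2) by auto
    \<comment> \<open>From \<open>M' < M < 2 * M'\<close> it follows that \<open>M / M'\<close> is
      no power of 2.\<close>
    have "M / 2 ^ i \<noteq> M' / 2 ^ j" for i j
    proof
      assume "M / 2 ^ i = M' / 2 ^ j"
      hence eq: "2 ^ j * M = 2 ^ i * M'" by (simp add: field_simps)
      show False
      proof (cases "i \<le> j")
        case True
        hence "(2::real) ^ i \<le> 2 ^ j" by (intro power_increasing) auto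
        hence "2 ^ i * M' \<le> 2 ^ j * M'" using M0 by (intro mult_right_mono) auto
        also have "\<dots> < 2 ^ j * M" using M(3) by simp
        finally show False using eq by simp
      next
        case False
        hence "(2::real) ^ Suc j \<le> 2 ^ i" by (intro power_increasing) auto
        hence "2 ^ Suc j * M' \<le> 2 ^ i * M'" using M0 by (intro mult_right_mono) auto
        moreover have "2 ^ j * M < 2 ^ j * (2 * M')" using gt by simp
        ultimately show False using eq by simp
      qed
    qed
    hence "geom 2 x n \<inter> geom 2 y m = {}" unfolding tops by auto
    hence nm: "n + m = 8"
      using card card_geom[of 2 x n] card_geom[of 2 y m] xy unfolding A
      by (subst (asm) card_Un_disjoint) auto
    \<comment> \<open>Seven terms of one progression already have 28 distinct sums, so both lengths
      may be taken at least 2.\<close>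
    have large: "22 \<le> card (A + A)" if "7 \<le> l" "z > 0" "geom 2 z l \<subseteq> A" for z l
    proof -
      have "7 * 8 \<le> l * (l + 1)" using that(1) by (intro mult_mono) auto
      also have "\<dots> = 2 * card (geom 2 z l + geom 2 z l)"
        using card_sumset_geom[of 2 z l] that(2) by simp
      finally have "28 \<le> card (geom 2 z l + geom 2 z l)" by simp
      also have "\<dots> \<le> card (A + A)"
        by (intro card_mono finite_set_plus fin set_plus_mono2 that)
      finally show ?thesis by simp
    qed
    consider "7 \<le> n" | "7 \<le> m" | "n \<ge> 2" "m \<ge> 2" using nm by linarith
    thus ?thesis
    proof cases
      case 3
      from doubling_pair_new_sum[OF _ M(3) 3 nm _ B_def] gt A tops
      show ?thesis using new by auto
    qed (use large xy A in auto)
  qed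
  show ?thesis
  proof (cases "2 * M' \<le> M")
    case True
    show ?thesis
    proof (rule new)
      show "2 * M' \<in> A + A" using set_plus_intro[OF M(2) M(2)] by simp
      have "b + c < 2 * M'" if "b \<in> B" "c \<in> B" for b c
        using M(4)[of b] M(4)[of c] that by (simp add: B_def)
      hence "2 * M' \<notin> B + B" by (fastforce simp: set_plus_def)
      moreover have "2 * M' \<noteq> M + a" if "a \<in> A" for a using True pos that by force
      ultimately show "2 * M' \<notin> (B + B) \<union> (+) M ` A" by auto
    qed
  next
    case False
    hence "M \<in> geom 2 x n \<and> M' \<in> geom 2 y m \<or> M \<in> geom 2 y m \<and> M' \<in> geom 2 x n"
      using M(1,2) factor[of x n] factor[of y m] x y unfolding A by blast
    thus ?thesis using distinct_tops[of x y n m] distinct_tops[of y x m n] False x y A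
      by (auto simp: Un_commute)
  qed
qed

text \<open>Commensurable progressions lie in a single one, where all \<open>k * (k + 1) / 2\<close>
  sums are distinct; for \<open>k \<ge> 3\<close> this exceeds the bound.\<close>

lemma card_sumset_rational_ratio:
  assumes r: "r \<in> \<rat>" "r > 1" "r \<noteq> 2" and x: "x > 0" and y: "y > 0" and nm: "n \<ge> 1" "m \<ge> 1"
    and A: "A = geom r x n \<union> geom r y m" and k: "card A = k" "k \<ge> 3"
  shows "k\<^sup>2 + (if even k then 10 else 8) \<le> 2 * card (A + A) + 3 * k"
proof (cases "\<exists>i j. r ^ i * x = r ^ j * y")
  case True
  then obtain i j where ij: "r ^ i * x = r ^ j * y" by blast
  have sub: "geom r z l \<subseteq> range (\<lambda>i. r ^ i * w)" if "z = r ^ c * w" for z w :: real and l c :: nat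
    using that by (auto simp: mult.assoc[symmetric] simp flip: power_add)
  have down: "z = r ^ (b - a) * w" if "r ^ a * z = r ^ b * w" "a \<le> b" for a b and z w :: real
  proof -
    have "r ^ b = r ^ a * r ^ (b - a)" using that(2) by (simp flip: power_add)
    thus ?thesis using that(1) r by (simp add: mult.assoc)
  qed
  have "\<exists>w>0. A \<subseteq> range (\<lambda>i. r ^ i * w)"
  proof (cases "i \<le> j")
    case True
    with sub[OF down[OF ij], of n] sub[of y 0 y m] y show ?thesis unfolding A by auto
  next
    case False
    with sub[OF down[OF ij[symmetric]], of m] sub[of x 0 x n] x show ?thesis unfolding A by auto
  qed
  then obtain w where "w > 0" "A \<subseteq> range (\<lambda>i. r ^ i * w)" by blast
  moreover have "finite A" by (simp add: A)
  ultimately have "2 * card (A + A) = k * (k + 1)" using card_sumset_powers[of r w A] r k by blast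
  thus ?thesis using k(2) by (simp add: power2_eq_square)
next
  case False
  then interpret incommensurable_progressions r x y using r x y by unfold_locales auto
  have "geom r x n \<inter> geom r y m = {}" using incomm by auto
  hence "n + m = k"
    using k(1) card_geom[OF r(2) x, of n] card_geom[OF r(2) y, of m] unfolding A
    by (subst (asm) card_Un_disjoint) auto
  from card_sumset_incommensurable[OF nm this k(2)] show ?thesis unfolding A .
qed

theorem theorem3p3:
  fixes A P Q :: "real set" and r :: real and k :: nat
  assumes "A \<subseteq> {0<..}" and "card A = k" and "r > 1"
    and "geometric_progression r P" and "geometric_progression r Q" and "A = P \<union> Q"
    and "k \<ge> 2"
  shows "(odd k \<and> r \<in> \<rat> \<and> r \<noteq> 2 \<longrightarrow>
            real (card (A + A)) \<ge> (real k ^ 2 - 3 * real k + 8) / 2)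
       \<and> (even k \<and> k \<noteq> 2 \<and> r \<in> \<rat> \<and> r \<noteq> 2 \<longrightarrow>
            real (card (A + A)) \<ge> (real k ^ 2 - 3 * real k + 10) / 2)
       \<and> (r \<ge> 2 \<longrightarrow> int (card (A + A)) \<ge> \<lceil>((real k + 1) ^ 2 + 3) / 4\<rceil>)
       \<and> (k = 8 \<and> r \<in> \<rat> \<and> r \<ge> 2 \<longrightarrow> card (A + A) \<ge> 22)"
proof -
  from assms(4-6) obtain x y n m where xy: "x > 0" "y > 0" "n \<ge> 1" "m \<ge> 1"
    and A: "A = geom r x n \<union> geom r y m" unfolding geometric_progression_def by blast
  have rational: "k\<^sup>2 + (if even k then 10 else 8) \<le> 2 * card (A + A) + 3 * k"
    if "r \<in> \<rat>" "r \<noteq> 2" "k \<ge> 3"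
    using card_sumset_rational_ratio[OF that(1) assms(3) that(2) xy A assms(2) that(3)] .
  have a: "real (card (A + A)) \<ge> (real k ^ 2 - 3 * real k + 8) / 2"
    if "odd k" "r \<in> \<rat>" "r \<noteq> 2"
  proof -
    have "k \<noteq> 2" using that(1) by auto
    with rational that assms(7) have "k\<^sup>2 + 8 \<le> 2 * card (A + A) + 3 * k" by simp
    from of_nat_mono[OF this, where 'a = real] show ?thesis by simp
  qed
  have b: "real (card (A + A)) \<ge> (real k ^ 2 - 3 * real k + 10) / 2"
    if "even k" "k \<noteq> 2" "r \<in> \<rat>" "r \<noteq> 2"
  proof -
    from rational that assms(7) have "k\<^sup>2 + 10 \<le> 2 * card (A + A) + 3 * k" by simp
    from of_nat_mono[OF this, where 'a = real] show ?thesis by simp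
  qed
  have c: "int (card (A + A)) \<ge> \<lceil>((real k + 1) ^ 2 + 3) / 4\<rceil>" if "r \<ge> 2"
  proof -
    have "thin A" unfolding A using that xy by (intro thin_Un_geom) auto
    hence "(k + 1)\<^sup>2 + 3 \<le> 4 * card (A + A)"
      using card_sumset_thin[of A] assms(1,2,7) A by auto
    from of_nat_mono[OF this, where 'a = real] show ?thesis by (simp add: ceiling_le_iff add.commute)
  qed
  have d: "card (A + A) \<ge> 22" if "k = 8" "r \<in> \<rat>" "r \<ge> 2"
  \<comment> \<open>For \<open>k = 8\<close> the bound in \<open>c\<close> gives only 21, while
    \<open>rational\<close> gives 25 when \<open>r \<noteq> 2\<close>.\<close>
  proof (cases "r = 2")
    case True
    thus ?thesis using card_sumset_doubling_eight[OF xy(1,2)] A assms(2) that(1) by simp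
  next
    case False
    with rational that show ?thesis by simp
  qed
  show ?thesis using a b c d by blast
qed

end
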